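(* Let $\mathcal{H}$ be a topological VE-space over a topologically ordered $*$-space $Z$, let $X$ be a nonempty set, and let $\mathbf{k}\colon X\times X\to\mathcal{L}_c^*(\mathcal{H})$ be a $2$-positive kernel. If $\mathbf{k}(x,x)$ is m-topologisable for all $x\in X$ then, for any $x,y\in X$ and any $p\in S(Z)$, there exists $C\ge0$ such that $$p([\mathbf{k}(y,x)h,\mathbf{k}(y,x)h])\le C\,p([h,h]),\quad h\in\mathcal{H}.$$ In particular, the linear operator $\mathbf{k}(y,x)$ is m-topologisable for all $x,y\in X$.
   Context: An ordered $*$-space is a complex vector space $Z$ with a conjugate linear involution $z\mapsto z^*$ and a cone $Z^+$ (closed under linear combinations with nonnegative coefficients) that is strict ($Z^+\cap(-Z^+)=\{0\}$) and consists of selfadjoint elements; for selfadjoint $z_1,z_2$, $z_1\ge z_2$ means $z_1-z_2\in Z^+$. A seminorm $p$ on $Z$ is increasing if $0\le x\le y$ implies $p(x)\le p(y)$. $Z$ is topologically ordered if it is also a Hausdorff locally convex space whose topology is generated by a family of absolutely convex neighbourhoods $C$ of the origin that are solid ($x\in C$, $0\le y\le x$ imply $y\in C$); equivalently, its topology is defined by a family of increasing seminorms. $S(Z)$ is the set of all continuous increasing seminorms on $Z$. A VE-space over $Z$ is a complex vector space $\mathcal{H}$ with a map (gramian) $[\cdot,\cdot]\colon\mathcal{H}\times\mathcal{H}\to Z$, linear in the second variable, with $[x,y]=[y,x]^*$, $[x,x]\ge0$, and $[x,x]=0$ iff $x=0$. When $Z$ is topologically ordered, $\mathcal{H}$ carries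 the Hausdorff locally convex topology generated by the seminorms $\tilde p(h)=p([h,h])^{1/2}$, $p\in S(Z)$, and is called a topological VE-space. A linear operator $T\colon\mathcal{H}\to\mathcal{H}$ is adjointable if there is a linear $T^*$ with $[Tg,h]=[g,T^*h]$ for all $g,h$; $\mathcal{L}_c^*(\mathcal{H})$ is the set of adjointable $T$ with both $T$ and $T^*$ continuous. A kernel $\mathbf{k}$ is $2$-positive if $\sum_{i,j=1}^2[\mathbf{k}(x_i,x_j)h_j,h_i]\ge0$ for all $x_1,x_2\in X$, $h_1,h_2\in\mathcal{H}$. A linear operator $T$ on $\mathcal{H}$ is m-topologisable if for every $p\in S(Z)$ there exist a constant $D_p\ge0$ and a continuous seminorm $r$ on $\mathcal{H}$ such that $p([T^nh,T^nh])^{1/2}\le D_p^n\,r(h)$ for all $n\in\mathbb{N}$ and $h\in\mathcal{H}$. *)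

theory Defs
  imports "HOL-Analysis.Analysis"
begin

text \<open>
  The scalar multiplications \<open>sZ\<close> and \<open>sH\<close> of the complex vector spaces are explicit parameters,
  subject to the library locale \<^locale>\<open>vector_space\<close> (over the field of complex numbers).
\<close>

definition seminorm :: "(complex \<Rightarrow> 'v::ab_group_add \<Rightarrow> 'v) \<Rightarrow> ('v \<Rightarrow> real) \<Rightarrow> bool" where
  "seminorm s p \<longleftrightarrow>
     (\<forall>x. 0 \<le> p x) \<and> (\<forall>c x. p (s c x) = cmod c * p x) \<and> (\<forall>x y. p (x + y) \<le> p x + p y)"

definition absolutely_convex :: "(complex \<Rightarrow> 'v::ab_group_add \<Rightarrow> 'v) \<Rightarrow> 'v set \<Rightarrow> bool" where
  "absolutely_convex s C \<longleftrightarrow>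
     (\<forall>x\<in>C. \<forall>y\<in>C. \<forall>a b. cmod a + cmod b \<le> 1 \<longrightarrow> s a x + s b y \<in> C)"

locale ordered_star_space = vector_space sZ
  for sZ :: "complex \<Rightarrow> 'z::ab_group_add \<Rightarrow> 'z" +
  fixes star :: "'z \<Rightarrow> 'z"
    and pos :: "'z set"
  assumes star_add: "star (x + y) = star x + star y"
    and star_scale: "star (sZ c x) = sZ (cnj c) (star x)"
    and star_star: "star (star x) = x"
    and pos_add: "x \<in> pos \<Longrightarrow> y \<in> pos \<Longrightarrow> x + y \<in> pos"
    and pos_scale: "x \<in> pos \<Longrightarrow> 0 \<le> a \<Longrightarrow> sZ (complex_of_real a) x \<in> pos"
    and pos_strict: "pos \<inter> uminus ` pos = {0}"
    and pos_selfadjoint: "x \<in> pos \<Longrightarrow> star x = x"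

definition star_le :: "('z::ab_group_add \<Rightarrow> 'z) \<Rightarrow> 'z set \<Rightarrow> 'z \<Rightarrow> 'z \<Rightarrow> bool" where
  "star_le star pos x y \<longleftrightarrow> star x = x \<and> star y = y \<and> y - x \<in> pos"

definition solid :: "('z::ab_group_add \<Rightarrow> 'z) \<Rightarrow> 'z set \<Rightarrow> 'z set \<Rightarrow> bool" where
  "solid star pos C \<longleftrightarrow>
     (\<forall>x\<in>C. \<forall>y. star_le star pos 0 y \<and> star_le star pos y x \<longrightarrow> y \<in> C)"

definition increasing_fun :: "('z::ab_group_add \<Rightarrow> 'z) \<Rightarrow> 'z set \<Rightarrow> ('z \<Rightarrow> real) \<Rightarrow> bool" where
  "increasing_fun star pos p \<longleftrightarrow>
     (\<forall>x y. star_le star pos 0 x \<and> star_le star pos x y \<longrightarrow> p x \<le> p y)"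

text \<open>
  The type classes provide the Hausdorff property and the continuity of the group operations.
  The topology is linearly generated by a family \<open>F\<close> of neighbourhoods of the origin: finite
  intersections of positive multiples of members of \<open>F\<close> form a base of neighbourhoods of the
  origin.  As the members of \<open>F\<close> are absolutely convex, local convexity is included.
\<close>

locale topologically_ordered_star_space = ordered_star_space sZ star pos
  for sZ :: "complex \<Rightarrow> 'z::{topological_ab_group_add, t2_space} \<Rightarrow> 'z"
    and star :: "'z \<Rightarrow> 'z"
    and pos :: "'z set" +
  assumes continuous_scale: "continuous_on UNIV (\<lambda>(c, z). sZ c z)"
    and solid_generated:
      "\<exists>F. (\<forall>C\<in>F. 0 \<in> interior C \<and> absolutely_convex sZ C \<and> solid star pos C) \<and>
           (\<forall>U. open U \<and> 0 \<in> U \<longrightarrow>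
              (\<exists>G e. finite G \<and> G \<subseteq> F \<and> 0 < e \<and> (\<Inter>C\<in>G. sZ (complex_of_real e) ` C) \<subseteq> U))"

text \<open>The set $S(Z)$.\<close>

definition cont_incr_seminorms ::
  "(complex \<Rightarrow> 'z::{ab_group_add, topological_space} \<Rightarrow> 'z) \<Rightarrow> ('z \<Rightarrow> 'z) \<Rightarrow> 'z set \<Rightarrow>
   ('z \<Rightarrow> real) set"
  where "cont_incr_seminorms sZ star pos =
    {p. seminorm sZ p \<and> continuous_on UNIV p \<and> increasing_fun star pos p}"

locale VE_space = Z: ordered_star_space sZ star pos + H: vector_space sH
  for sZ :: "complex \<Rightarrow> 'z::ab_group_add \<Rightarrow> 'z"
    and star :: "'z \<Rightarrow> 'z"
    and pos :: "'z set"
    and sH :: "complex \<Rightarrow> 'h::ab_group_add \<Rightarrow> 'h" +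
  fixes gram :: "'h \<Rightarrow> 'h \<Rightarrow> 'z"
  assumes gram_linear: "Vector_Spaces.linear sH sZ (gram x)"
    and gram_hermitian: "gram x y = star (gram y x)"
    and gram_nonneg: "star_le star pos 0 (gram x x)"
    and gram_definite: "gram x x = 0 \<longleftrightarrow> x = 0"

locale topological_VE_space =
  topologically_ordered_star_space sZ star pos + VE_space sZ star pos sH gram
  for sZ :: "complex \<Rightarrow> 'z::{topological_ab_group_add, t2_space} \<Rightarrow> 'z"
    and star :: "'z \<Rightarrow> 'z"
    and pos :: "'z set"
    and sH :: "complex \<Rightarrow> 'h::ab_group_add \<Rightarrow> 'h"
    and gram :: "'h \<Rightarrow> 'h \<Rightarrow> 'z"

definition gram_seminorm :: "('h \<Rightarrow> 'h \<Rightarrow> 'z) \<Rightarrow> ('z \<Rightarrow> real) \<Rightarrow> 'h \<Rightarrow> real" where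
  "gram_seminorm gram p h = sqrt (p (gram h h))"

definition VE_topology ::
  "(complex \<Rightarrow> 'z::{ab_group_add, topological_space} \<Rightarrow> 'z) \<Rightarrow> ('z \<Rightarrow> 'z) \<Rightarrow> 'z set \<Rightarrow>
   ('h::ab_group_add \<Rightarrow> 'h \<Rightarrow> 'z) \<Rightarrow> 'h topology"
  where "VE_topology sZ star pos gram =
    topology_generated_by
      {{g. gram_seminorm gram p (g - h) < e} | p h e.
         p \<in> cont_incr_seminorms sZ star pos \<and> 0 < e}"

text \<open>The set $\mathcal{L}_c^*(\mathcal{H})$; the adjoint \<open>T'\<close> is unique if it exists.\<close>

definition cont_adjointable ::
  "(complex \<Rightarrow> 'z::{ab_group_add, topological_space} \<Rightarrow> 'z) \<Rightarrow> ('z \<Rightarrow> 'z) \<Rightarrow> 'z set \<Rightarrow>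
   (complex \<Rightarrow> 'h::ab_group_add \<Rightarrow> 'h) \<Rightarrow> ('h \<Rightarrow> 'h \<Rightarrow> 'z) \<Rightarrow> ('h \<Rightarrow> 'h) set"
  where "cont_adjointable sZ star pos sH gram =
    {T. Vector_Spaces.linear sH sH T \<and>
        continuous_map (VE_topology sZ star pos gram) (VE_topology sZ star pos gram) T \<and>
        (\<exists>T'. Vector_Spaces.linear sH sH T' \<and>
              (\<forall>g h. gram (T g) h = gram g (T' h)) \<and>
              continuous_map (VE_topology sZ star pos gram) (VE_topology sZ star pos gram) T')}"

definition two_positive ::
  "('z::ab_group_add \<Rightarrow> 'z) \<Rightarrow> 'z set \<Rightarrow> ('h \<Rightarrow> 'h \<Rightarrow> 'z) \<Rightarrow> 'x set \<Rightarrow>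
   ('x \<Rightarrow> 'x \<Rightarrow> 'h \<Rightarrow> 'h) \<Rightarrow> bool"
  where "two_positive star pos gram X k \<longleftrightarrow>
    (\<forall>(x :: nat \<Rightarrow> 'x) (h :: nat \<Rightarrow> 'h). (\<forall>i\<in>{1..2}. x i \<in> X) \<longrightarrow>
       star_le star pos 0 (\<Sum>i=1..2. \<Sum>j=1..2. gram (k (x i) (x j) (h j)) (h i)))"

text \<open>
  Letting \<open>n\<close> start at 0 is immaterial: the seminorm \<open>r\<close> may always be replaced by
  its maximum with \<open>gram_seminorm gram p\<close>.
\<close>

definition m_topologisable ::
  "(complex \<Rightarrow> 'z::{ab_group_add, topological_space} \<Rightarrow> 'z) \<Rightarrow> ('z \<Rightarrow> 'z) \<Rightarrow> 'z set \<Rightarrow>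
   (complex \<Rightarrow> 'h::ab_group_add \<Rightarrow> 'h) \<Rightarrow> ('h \<Rightarrow> 'h \<Rightarrow> 'z) \<Rightarrow> ('h \<Rightarrow> 'h) \<Rightarrow> bool"
  where "m_topologisable sZ star pos sH gram T \<longleftrightarrow>
    Vector_Spaces.linear sH sH T \<and>
    (\<forall>p \<in> cont_incr_seminorms sZ star pos.
       \<exists>D r. 0 \<le> D \<and> seminorm sH r \<and>
         continuous_map (VE_topology sZ star pos gram) euclideanreal r \<and>
         (\<forall>n h. gram_seminorm gram p ((T ^^ n) h) \<le> D ^ n * r h))"

end

theory Submission imports Defs begin

text \<open>
  Write $\tilde p(h) = p([h,h])^{1/2}$.  Two mechanisms give the bound.

  First, a selfadjoint m-topologisable operator $A$ is bounded for each $\tilde p$ separately, with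
  the growth constant $D_p$ as its bound.  Indeed $[A^{2m}h,h] = [A^mh,A^mh] \ge 0$, and a Schwarz
  inequality with constant one holds for positive values of the gramian, so
  $\tilde p(A^mh)^2 \le \tilde p(A^{2m}h)\,\tilde p(h)$.  Along the powers $m = 2^n$ this turns into
  $\tilde p(Ah)^{2^n} \le \tilde p(h)^{2^n-1}\,\tilde p(A^{2^n}h) \le \tilde p(h)^{2^n-1} D_p^{2^n} r(h)$;
  extracting the $2^n$-th root and letting $n \to \infty$ removes $r$ (the argument behind the
  spectral radius formula), so $\tilde p(Ah) \le D_p\,\tilde p(h)$.
  This is \<open>selfadjoint_growth_imp_bounded\<close>.

  Second, 2-positivity makes the kernel hermitian; in particular $\mathbf{k}(x,x)$ is selfadjoint,
  so that the first part applies to it.  Testing 2-positivity on the pair $(g, -t\,Tg)$ with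
  $T = \mathbf{k}(y,x)$ and $t > 0$ gives
  $2t[Tg,Tg] \le [\mathbf{k}(x,x)g,g] + t^2[\mathbf{k}(y,y)Tg,Tg]$.
  Both terms on the right are positive, so by Schwarz and the first part they are controlled by
  $p([g,g])$ and $p([Tg,Tg])$.  For small $t$ the last term is absorbed in the left-hand side
  (\<open>two_positive_imp_bounded\<close>).

  An operator bounded for every $\tilde p$ is m-topologisable with $r = \tilde p$; here one has to
  know that $\tilde p$ is a continuous seminorm (\<open>seminorm_gram_seminorm\<close> and
  \<open>continuous_gram_seminorm\<close>).
\<close>

section \<open>Two facts about real numbers\<close>

text \<open>The converse of weighted AM--GM: the infimum of the right-hand side over \<open>s\<close> is $2ab$.\<close>

lemma le_mult_if_weighted_bound:
  fixes a b w :: real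
  assumes "0 \<le> a" "0 \<le> b" and bound: "\<And>s. 0 < s \<Longrightarrow> 2 * w \<le> s * a\<^sup>2 + b\<^sup>2 / s"
  shows "w \<le> a * b"
proof -
  have perturbed: "w \<le> (a + e) * (b + e)" if "0 < e" for e
  proof -
    \<comment> \<open>The minimiser $s = b/a$ need not exist, hence the perturbation.\<close>
    define s where "s = (b + e) / (a + e)"
    have pos: "0 < a + e" "0 < b + e" using assms that by auto
    then have "0 < s" by (simp add: s_def)
    have "s * a\<^sup>2 \<le> s * (a + e)\<^sup>2"
      using \<open>0 < s\<close> that assms by (intro mult_left_mono power_mono) auto
    moreover have "s * (a + e)\<^sup>2 = (a + e) * (b + e)"
      using pos by (simp add: s_def power2_eq_square)
    moreover have "b\<^sup>2 / s \<le> (b + e)\<^sup>2 / s"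
      using \<open>0 < s\<close> that assms by (intro divide_right_mono power_mono) auto
    moreover have "(b + e)\<^sup>2 / s = (a + e) * (b + e)"
      using pos by (simp add: s_def power2_eq_square)
    ultimately show ?thesis using bound[OF \<open>0 < s\<close>] by linarith
  qed
  have "((\<lambda>e. (a + e) * (b + e)) \<longlongrightarrow> (a + 0) * (b + 0)) (at_right 0)"
    by (intro tendsto_intros)
  moreover have "eventually (\<lambda>e. w \<le> (a + e) * (b + e)) (at_right 0)"
    using perturbed by (simp add: eventually_at_right_less eventually_at_filter)
  ultimately show ?thesis
    using tendsto_lowerbound[of _ _ "at_right (0::real)" w] by simp
qed

lemma le_if_all_powers_bounded:
  fixes q d K :: real
  assumes "0 \<le> d" and bound: "\<And>n. q ^ (2 ^ n) \<le> d ^ (2 ^ n) * K"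
  shows "q \<le> d"
proof (rule ccontr)
  assume "\<not> q \<le> d"
  show False
  proof (cases "d = 0")
    case True
    then show False using bound[of 0] \<open>\<not> q \<le> d\<close> by simp
  next
    case False
    then have "1 < q / d" using assms(1) \<open>\<not> q \<le> d\<close> by simp
    then obtain n where n: "K < (q / d) ^ n" using real_arch_pow by blast
    also have "\<dots> \<le> (q / d) ^ (2 ^ n)"
      using \<open>1 < q / d\<close> by (intro power_increasing) auto
    also have "\<dots> \<le> K"
      using bound[of n] False assms(1) by (simp add: power_divide divide_simps mult.commute)
    finally show False by simp
  qed
qed

section \<open>Algebra of the gramian\<close>

context VE_space
begin

lemma star_diff: "star (x - y) = star x - star y"
  using Z.star_add[of "x - y" y] by simp

lemma gram_add_right: "gram x (y + z) = gram x y + gram x z"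
  and gram_scale_right: "gram x (sH c y) = sZ c (gram x y)"
  and gram_diff_right: "gram x (y - z) = gram x y - gram x z"
proof -
  interpret L: Vector_Spaces.linear sH sZ "gram x" by (rule gram_linear)
  show "gram x (y + z) = gram x y + gram x z" by (rule L.add)
  show "gram x (sH c y) = sZ c (gram x y)" by (rule L.scale)
  show "gram x (y - z) = gram x y - gram x z" by (rule L.diff)
qed

lemma gram_add_left: "gram (x + y) z = gram x z + gram y z"
  by (simp add: gram_hermitian[of _ z] gram_add_right Z.star_add)

lemma gram_scale_left: "gram (sH c x) y = sZ (cnj c) (gram x y)"
  by (simp add: gram_hermitian[of _ y] gram_scale_right Z.star_scale)

lemma gram_diff_left: "gram (x - y) z = gram x z - gram y z"
  by (simp add: gram_hermitian[of _ z] gram_diff_right star_diff)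

lemma gram_zero [simp]: "gram x 0 = 0" "gram 0 x = 0"
  using gram_diff_right[of x 0 0] gram_diff_left[of 0 0 x] by auto

lemma gram_self_pos: "gram x x \<in> pos"
  using gram_nonneg[of x] by (simp add: star_le_def)

text \<open>Expand the positive element $[su-v,su-v]$ and divide by \<open>s\<close>.\<close>

lemma weighted_cross_terms_le:
  assumes "0 < s"
  shows "sZ (complex_of_real s) (gram u u) + sZ (complex_of_real (1 / s)) (gram v v)
           - (gram u v + gram v u) \<in> pos"
proof -
  let ?w = "sH (complex_of_real s) u - v"
  have "sZ (complex_of_real (1 / s)) (gram ?w ?w) \<in> pos"
    using assms by (intro Z.pos_scale gram_self_pos) auto
  moreover have "sZ (complex_of_real (1 / s)) (gram ?w ?w) =
      sZ (complex_of_real s) (gram u u) + sZ (complex_of_real (1 / s)) (gram v v)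
           - (gram u v + gram v u)"
    using assms
    by (simp add: gram_diff_left gram_diff_right gram_scale_left gram_scale_right
        Z.scale_right_diff_distrib algebra_simps)
  ultimately show ?thesis by simp
qed

section \<open>The seminorms on a VE-space\<close>

lemma increasing_seminorm_mono:
  assumes "increasing_fun star pos p" "x \<in> pos" "y - x \<in> pos"
  shows "p x \<le> p y"
proof -
  have "y \<in> pos" using Z.pos_add[OF assms(2,3)] by simp
  moreover have "star 0 = 0" using star_diff[of 0 0] by simp
  ultimately show ?thesis
    using assms Z.pos_selfadjoint unfolding increasing_fun_def star_le_def by simp
qed

lemma seminorm_real_scale:
  assumes "seminorm sZ p" "0 \<le> t"
  shows "p (sZ (complex_of_real t) z) = t * p z"
  using assms by (simp add: seminorm_def)

lemma seminorm_weighted_sum_le: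
  assumes "seminorm sZ p" "0 \<le> s" "0 \<le> t"
  shows "p (sZ (complex_of_real s) y + sZ (complex_of_real t) z) \<le> s * p y + t * p z"
  using assms(1)[unfolded seminorm_def] seminorm_real_scale[OF assms(1)] assms(2,3)
  by (metis (no_types))

lemma gram_seminorm_nonneg:
  assumes "seminorm sZ p"
  shows "0 \<le> gram_seminorm gram p u"
  using assms by (simp add: gram_seminorm_def seminorm_def)

lemma gram_seminorm_square:
  assumes "seminorm sZ p"
  shows "(gram_seminorm gram p u)\<^sup>2 = p (gram u u)"
  using assms by (simp add: gram_seminorm_def seminorm_def)

text \<open>
  For a positive value of the gramian the cross terms $[u,v]$ and $[v,u]$ coincide, which is why
  the constant is one; for general values one first has to split into real and imaginary parts.
\<close>

lemma Schwarz_if_gram_pos: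
  assumes p: "seminorm sZ p" "increasing_fun star pos p" and pos: "gram u v \<in> pos"
  shows "p (gram u v) \<le> gram_seminorm gram p u * gram_seminorm gram p v"
proof (rule le_mult_if_weighted_bound)
  fix s :: real assume "0 < s"
  have "gram v u = gram u v"
    using gram_hermitian[of v u] Z.pos_selfadjoint[OF pos] by simp
  then have "p (gram u v + gram u v) \<le>
      p (sZ (complex_of_real s) (gram u u) + sZ (complex_of_real (1 / s)) (gram v v))"
    using weighted_cross_terms_le[OF \<open>0 < s\<close>, of u v] pos
    by (intro increasing_seminorm_mono[OF p(2)]) (auto intro: Z.pos_add)
  also have "\<dots> \<le> s * p (gram u u) + 1 / s * p (gram v v)"
    using p(1) \<open>0 < s\<close> by (intro seminorm_weighted_sum_le) auto
  also have "gram u v + gram u v = sZ (complex_of_real 2) (gram u v)"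
    using Z.scale_left_distrib[of 1 1 "gram u v"] by simp
  also have "p \<dots> = 2 * p (gram u v)" using p(1) by (intro seminorm_real_scale) auto
  finally show "2 * p (gram u v) \<le>
      s * (gram_seminorm gram p u)\<^sup>2 + (gram_seminorm gram p v)\<^sup>2 / s"
    by (simp add: gram_seminorm_square[OF p(1)])
qed (use gram_seminorm_nonneg[OF p(1)] in auto)

text \<open>
  Without a scalar-valued inner product, the triangle inequality comes from
  $[u+v,u+v] \le (1+s)[u,u] + (1+1/s)[v,v]$, optimised over \<open>s\<close>.
\<close>

lemma gram_seminorm_triangle:
  assumes p: "seminorm sZ p" "increasing_fun star pos p"
  shows "gram_seminorm gram p (u + v) \<le> gram_seminorm gram p u + gram_seminorm gram p v"
proof -
  let ?a = "gram_seminorm gram p u" and ?b = "gram_seminorm gram p v"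
  let ?c = "gram_seminorm gram p (u + v)"
  have "(?c\<^sup>2 - ?a\<^sup>2 - ?b\<^sup>2) / 2 \<le> ?a * ?b"
  proof (rule le_mult_if_weighted_bound)
    fix s :: real assume s: "0 < s"
    let ?R = "sZ (complex_of_real (1 + s)) (gram u u)
      + sZ (complex_of_real (1 + 1 / s)) (gram v v)"
    have "?R - gram (u + v) (u + v) = sZ (complex_of_real s) (gram u u)
        + sZ (complex_of_real (1 / s)) (gram v v) - (gram u v + gram v u)"
      by (simp add: gram_add_left gram_add_right Z.scale_left_distrib)
    then have "p (gram (u + v) (u + v)) \<le> p ?R"
      using weighted_cross_terms_le[OF s, of u v]
      by (intro increasing_seminorm_mono[OF p(2)] gram_self_pos) auto
    also have "\<dots> \<le> (1 + s) * p (gram u u) + (1 + 1 / s) * p (gram v v)"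
      using p(1) s by (intro seminorm_weighted_sum_le) auto
    finally show "2 * ((?c\<^sup>2 - ?a\<^sup>2 - ?b\<^sup>2) / 2) \<le> s * ?a\<^sup>2 + ?b\<^sup>2 / s"
      by (simp add: gram_seminorm_square[OF p(1)] algebra_simps)
  qed (use gram_seminorm_nonneg[OF p(1)] in auto)
  then have "?c\<^sup>2 \<le> (?a + ?b)\<^sup>2" by (simp add: power2_sum)
  then show ?thesis
    using gram_seminorm_nonneg[OF p(1)] by (meson add_nonneg_nonneg power2_le_imp_le)
qed

lemma gram_seminorm_scale:
  assumes "seminorm sZ p"
  shows "gram_seminorm gram p (sH c u) = cmod c * gram_seminorm gram p u"
proof -
  have "p (gram (sH c u) (sH c u)) = (cmod c)\<^sup>2 * p (gram u u)"
    using assms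
    by (simp add: seminorm_def gram_scale_left gram_scale_right norm_mult power2_eq_square)
  then show ?thesis by (simp add: gram_seminorm_def real_sqrt_mult)
qed

lemma seminorm_gram_seminorm:
  assumes "seminorm sZ p" "increasing_fun star pos p"
  shows "seminorm sH (gram_seminorm gram p)"
  using gram_seminorm_nonneg[of p] gram_seminorm_scale[of p] gram_seminorm_triangle[of p] assms
  by (simp add: seminorm_def[of sH])

lemma gram_seminorm_diff_le:
  assumes "seminorm sZ p" "increasing_fun star pos p"
  shows "\<bar>gram_seminorm gram p u - gram_seminorm gram p v\<bar> \<le> gram_seminorm gram p (u - v)"
proof -
  have "gram_seminorm gram p (v - u) = gram_seminorm gram p (u - v)"
    using gram_seminorm_scale[OF assms(1), of "-1" "u - v"] by simp
  then show ?thesis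
    using gram_seminorm_triangle[OF assms, of "u - v" v]
      gram_seminorm_triangle[OF assms, of "v - u" u] by simp
qed

section \<open>Selfadjoint operators of geometric growth\<close>

lemma gram_funpow_selfadjoint:
  assumes "\<And>g h. gram (A g) h = gram g (A h)"
  shows "gram ((A ^^ n) g) h = gram g ((A ^^ n) h)"
  by (induction n arbitrary: g h) (simp_all add: assms funpow_swap1)

lemma gram_seminorm_square_le_double_power:
  assumes p: "seminorm sZ p" "increasing_fun star pos p"
    and selfadj: "\<And>g h. gram (A g) h = gram g (A h)"
  shows "(gram_seminorm gram p ((A ^^ m) h))\<^sup>2
           \<le> gram_seminorm gram p ((A ^^ (2 * m)) h) * gram_seminorm gram p h"
proof -
  have eq: "gram ((A ^^ (2 * m)) h) h = gram ((A ^^ m) h) ((A ^^ m) h)"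
    by (simp add: mult_2 funpow_add gram_funpow_selfadjoint[OF selfadj])
  then have "gram ((A ^^ (2 * m)) h) h \<in> pos" using gram_self_pos by simp
  from Schwarz_if_gram_pos[OF p this] show ?thesis
    by (simp add: gram_seminorm_square[OF p(1)] eq)
qed

text \<open>
  For a given \<open>h\<close> the number \<open>r h\<close> stays fixed while the exponent $2^n$ grows, so it disappears in
  the limit of the $2^n$-th roots.
\<close>

lemma selfadjoint_growth_imp_bounded:
  assumes p: "seminorm sZ p" "increasing_fun star pos p"
    and selfadj: "\<And>g h. gram (A g) h = gram g (A h)"
    and "0 \<le> d" and growth: "\<And>n h. gram_seminorm gram p ((A ^^ n) h) \<le> d ^ n * r h"
  shows "gram_seminorm gram p (A h) \<le> d * gram_seminorm gram p h"
proof -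
  define a where "a = gram_seminorm gram p h"
  define b where "b n = gram_seminorm gram p ((A ^^ (2 ^ n)) h)" for n :: nat
  have nonneg: "0 \<le> a" "0 \<le> b n" for n
    using gram_seminorm_nonneg[OF p(1)] by (auto simp: a_def b_def)
  have step: "(b n)\<^sup>2 \<le> b (Suc n) * a" for n
    using gram_seminorm_square_le_double_power[OF p selfadj, of "2 ^ n" h]
    by (simp add: a_def b_def)
  have "b 0 \<le> d * a"
  proof (cases "a = 0")
    case True
    then show ?thesis using step[of 0] by simp
  next
    case False
    then have "0 < a" using nonneg by simp
    have "(b 0 / a) ^ (2 ^ n) \<le> b n / a" for n
    proof (induction n)
      case (Suc n)
      have "(b 0 / a) ^ (2 ^ Suc n) = ((b 0 / a) ^ (2 ^ n))\<^sup>2"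
        by (simp add: power_mult[symmetric] mult.commute)
      also have "\<dots> \<le> (b n / a)\<^sup>2" using Suc nonneg by (intro power_mono) auto
      also have "\<dots> \<le> b (Suc n) / a"
        using step[of n] \<open>0 < a\<close> by (simp add: power2_eq_square divide_simps)
      finally show ?case .
    qed simp
    moreover have "b n / a \<le> d ^ (2 ^ n) * (r h / a)" for n
      using growth[of "2 ^ n" h] \<open>0 < a\<close> by (simp add: b_def divide_right_mono)
    ultimately have "(b 0 / a) ^ (2 ^ n) \<le> d ^ (2 ^ n) * (r h / a)" for n
      by (rule order_trans)
    then have "b 0 / a \<le> d" by (rule le_if_all_powers_bounded[OF \<open>0 \<le> d\<close>])
    then show ?thesis using \<open>0 < a\<close> by (simp add: divide_simps)
  qed
  then show ?thesis by (simp add: a_def b_def)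
qed

section \<open>Kernels that are 2-positive\<close>

lemma two_positive_pos:
  assumes "two_positive star pos gram X k" "x \<in> X" "y \<in> X"
  shows "gram (k x x g) g + gram (k x y h) g + (gram (k y x g) h + gram (k y y h) h) \<in> pos"
proof -
  let ?x = "\<lambda>i::nat. if i = 1 then x else y" and ?h = "\<lambda>i::nat. if i = 1 then g else h"
  have "star_le star pos 0 (\<Sum>i=1..2. \<Sum>j=1..2. gram (k (?x i) (?x j) (?h j)) (?h i))"
    using assms(1)[unfolded two_positive_def, rule_format, of ?x ?h] assms(2,3) by simp
  moreover have "{1..2} = {1, 2::nat}" by auto
  ultimately show ?thesis by (simp add: star_le_def)
qed

lemma two_positive_diag_pos:
  assumes "two_positive star pos gram X k" "x \<in> X" "Vector_Spaces.linear sH sH (k x x)"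
  shows "gram (k x x g) g \<in> pos"
proof -
  interpret L: Vector_Spaces.linear sH sH "k x x" by (rule assms(3))
  show ?thesis using two_positive_pos[OF assms(1,2,2), of g 0] by (simp add: L.zero)
qed

text \<open>
  Positive elements are selfadjoint, so the sum of the two off-diagonal terms is; replacing \<open>h\<close> by
  $\mathrm{i}h$ separates them, as in the polarisation of a quadratic form.
\<close>

lemma two_positive_imp_hermitian:
  assumes k: "two_positive star pos gram X k" "x \<in> X" "y \<in> X"
    and lin: "\<And>u v. u \<in> X \<Longrightarrow> v \<in> X \<Longrightarrow> Vector_Spaces.linear sH sH (k u v)"
  shows "gram (k y x g) h = gram g (k x y h)"
proof -
  have offdiag: "gram g (k x y h) + gram h (k y x g) = gram (k x y h) g + gram (k y x g) h" for h
  proof -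
    note pos = two_positive_pos[OF k, of g h] two_positive_diag_pos[OF k(1,2) lin, of g]
      two_positive_diag_pos[OF k(1,3) lin, of h]
    show ?thesis
      using pos[THEN Z.pos_selfadjoint] k(2,3)
      by (simp add: Z.star_add gram_hermitian[symmetric])
  qed
  interpret L: Vector_Spaces.linear sH sH "k x y" by (intro lin k)
  have "sZ \<i> (gram g (k x y h) - gram h (k y x g)) = sZ \<i> (gram (k y x g) h - gram (k x y h) g)"
    using offdiag[of "sH \<i> h"]
    by (simp add: L.scale gram_scale_left gram_scale_right Z.scale_right_diff_distrib)
  then have "gram g (k x y h) - gram h (k y x g) = gram (k y x g) h - gram (k x y h) g"
    by (simp add: Z.scale_left_imp_eq)
  then have "(gram g (k x y h) - gram h (k y x g)) + (gram g (k x y h) + gram h (k y x g)) =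
      (gram (k y x g) h - gram (k x y h) g) + (gram (k x y h) g + gram (k y x g) h)"
    by (simp only: offdiag)
  then have "gram g (k x y h) + gram g (k x y h) = gram (k y x g) h + gram (k y x g) h"
    by simp
  then have "sZ 2 (gram g (k x y h)) = sZ 2 (gram (k y x g) h)"
    using Z.scale_left_distrib[of 1 1] by simp
  then show ?thesis by (simp add: Z.scale_left_imp_eq)
qed

text \<open>
  The operator norm estimate for the off-diagonal entry of a positive $2 \times 2$ operator matrix,
  carried out for a single seminorm.
\<close>

lemma two_positive_imp_bounded:
  assumes k: "two_positive star pos gram X k" "x \<in> X" "y \<in> X"
    and lin: "\<And>u v. u \<in> X \<Longrightarrow> v \<in> X \<Longrightarrow> Vector_Spaces.linear sH sH (k u v)"
    and p: "seminorm sZ p" "increasing_fun star pos p"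
    and bx: "\<And>h. gram_seminorm gram p (k x x h) \<le> a * gram_seminorm gram p h"
    and by': "\<And>h. gram_seminorm gram p (k y y h) \<le> b * gram_seminorm gram p h"
    and "0 < b"
  shows "p (gram (k y x g) (k y x g)) \<le> b * a * p (gram g g)"
proof -
  \<comment> \<open>With this choice the absorbed term is at most half of the left-hand side.\<close>
  define t where "t = 1 / b"
  have t: "0 < t" using \<open>0 < b\<close> by (simp add: t_def)
  define u where "u = k y x g"
  let ?P = "gram (k x x g) g" and ?Q = "gram (k y y u) u"
  interpret L: Vector_Spaces.linear sH sH "k x y" by (intro lin k)
  interpret M: Vector_Spaces.linear sH sH "k y y" by (intro lin k)
  have adj: "gram (k x y u) g = gram u u"
    using two_positive_imp_hermitian[OF k(1,3,2) lin, of u g] by (simp add: u_def)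
  let ?h = "sH (complex_of_real (- t)) u"
  have "gram (k x x g) g + gram (k x y ?h) g + (gram (k y x g) ?h + gram (k y y ?h) ?h) =
      (sZ (complex_of_real 1) ?P + sZ (complex_of_real (t\<^sup>2)) ?Q)
        - sZ (complex_of_real (2 * t)) (gram u u)"
  proof -
    have "sZ (complex_of_real (2 * t)) (gram u u) =
        sZ (complex_of_real t) (gram u u) + sZ (complex_of_real t) (gram u u)"
      by (simp only: mult_2 of_real_add Z.scale_left_distrib)
    then show ?thesis
      unfolding L.scale M.scale gram_scale_left gram_scale_right adj u_def[symmetric]
      by (simp add: power2_eq_square)
  qed
  then have "(sZ (complex_of_real 1) ?P + sZ (complex_of_real (t\<^sup>2)) ?Q)
        - sZ (complex_of_real (2 * t)) (gram u u) \<in> pos"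
    using two_positive_pos[OF k, of g ?h] by (simp only:)
  then have "p (sZ (complex_of_real (2 * t)) (gram u u)) \<le>
      p (sZ (complex_of_real 1) ?P + sZ (complex_of_real (t\<^sup>2)) ?Q)"
    using t by (intro increasing_seminorm_mono[OF p(2)] Z.pos_scale gram_self_pos) auto
  also have "\<dots> \<le> 1 * p ?P + t\<^sup>2 * p ?Q"
    using p(1) by (intro seminorm_weighted_sum_le) auto
  finally have main: "2 * t * p (gram u u) \<le> p ?P + t\<^sup>2 * p ?Q"
    using seminorm_real_scale[OF p(1), of "2 * t"] t by simp
  have diag: "p (gram (k z z v) v) \<le> c * p (gram v v)"
    if "z \<in> X" and c: "gram_seminorm gram p (k z z v) \<le> c * gram_seminorm gram p v" for z v c
  proof -
    have "p (gram (k z z v) v) \<le> gram_seminorm gram p (k z z v) * gram_seminorm gram p v"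
      using two_positive_diag_pos[OF k(1)] lin that by (intro Schwarz_if_gram_pos[OF p]) auto
    also have "\<dots> \<le> c * gram_seminorm gram p v * gram_seminorm gram p v"
      using c gram_seminorm_nonneg[OF p(1)] by (intro mult_right_mono) auto
    also have "\<dots> = c * p (gram v v)"
      using gram_seminorm_square[OF p(1), of v] by (simp add: power2_eq_square)
    finally show ?thesis .
  qed
  have "t\<^sup>2 * p ?Q \<le> t\<^sup>2 * (b * p (gram u u))"
    using diag[OF k(3) by'] by (intro mult_left_mono) auto
  also have "\<dots> = t * p (gram u u)" using \<open>0 < b\<close> by (simp add: t_def power2_eq_square)
  finally have "t * p (gram u u) \<le> a * p (gram g g)"
    using main diag[OF k(2) bx, of g] by linarith
  then show ?thesis using \<open>0 < b\<close> by (simp add: t_def u_def divide_simps mult_ac)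
qed

end

section \<open>Bounded operators are m-topologisable\<close>

context topological_VE_space
begin

lemma continuous_gram_seminorm:
  assumes p: "p \<in> cont_incr_seminorms sZ star pos"
  shows "continuous_map (VE_topology sZ star pos gram) euclideanreal (gram_seminorm gram p)"
proof -
  have sp: "seminorm sZ p" "increasing_fun star pos p"
    using p by (auto simp: cont_incr_seminorms_def)
  have ball_open: "openin (VE_topology sZ star pos gram) {g. gram_seminorm gram p (g - h) < e}"
    if "0 < e" for h e
    unfolding VE_topology_def using p that by (intro topology_generated_by_Basis) blast
  have zero: "gram_seminorm gram p (h - h) = 0" for h
    using gram_seminorm_scale[OF sp(1), of 0 0] by simp
  have "h \<in> topspace (VE_topology sZ star pos gram)" for h
  proof -
    have "h \<in> {g. gram_seminorm gram p (g - h) < 1}"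
      by (simp only: mem_Collect_eq zero zero_less_one)
    then show ?thesis using openin_subset[OF ball_open[OF zero_less_one, of h]] by blast
  qed
  then have "topspace (VE_topology sZ star pos gram) = UNIV" by blast
  moreover have "openin (VE_topology sZ star pos gram) {h. gram_seminorm gram p h \<in> U}"
    if "open U" for U
  proof (subst openin_subopen, intro ballI)
    fix h assume "h \<in> {h. gram_seminorm gram p h \<in> U}"
    then have "gram_seminorm gram p h \<in> U" by simp
    then obtain e where e: "0 < e" "ball (gram_seminorm gram p h) e \<subseteq> U"
      using openE[OF \<open>open U\<close>, of "gram_seminorm gram p h"] by blast
    have "{g. gram_seminorm gram p (g - h) < e} \<subseteq> {h. gram_seminorm gram p h \<in> U}"
    proof
      fix g assume "g \<in> {g. gram_seminorm gram p (g - h) < e}"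
      then have "gram_seminorm gram p g \<in> ball (gram_seminorm gram p h) e"
        using gram_seminorm_diff_le[OF sp, of g h] by (simp add: dist_real_def abs_minus_commute)
      then show "g \<in> {h. gram_seminorm gram p h \<in> U}" using e(2) by auto
    qed
    moreover have "h \<in> {g. gram_seminorm gram p (g - h) < e}"
      using e(1) by (simp only: mem_Collect_eq zero)
    ultimately show "\<exists>T. openin (VE_topology sZ star pos gram) T \<and> h \<in> T \<and>
        T \<subseteq> {h. gram_seminorm gram p h \<in> U}"
      using ball_open[OF e(1), of h] by blast
  qed
  ultimately show ?thesis by (simp add: continuous_map_def)
qed

lemma bounded_imp_m_topologisable:
  assumes lin: "Vector_Spaces.linear sH sH T"
    and bounded: "\<And>p. p \<in> cont_incr_seminorms sZ star pos \<Longrightarrow>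
      \<exists>C\<ge>0. \<forall>h. p (gram (T h) (T h)) \<le> C * p (gram h h)"
  shows "m_topologisable sZ star pos sH gram T"
  unfolding m_topologisable_def
proof (intro conjI ballI)
  fix p assume p: "p \<in> cont_incr_seminorms sZ star pos"
  then have sp: "seminorm sZ p" "increasing_fun star pos p"
    by (auto simp: cont_incr_seminorms_def)
  obtain C where C: "0 \<le> C" "\<And>h. p (gram (T h) (T h)) \<le> C * p (gram h h)"
    using bounded[OF p] by blast
  have step: "gram_seminorm gram p (T h) \<le> sqrt C * gram_seminorm gram p h" for h
    using C(2)[of h] by (simp add: gram_seminorm_def real_sqrt_mult[symmetric])
  have "gram_seminorm gram p ((T ^^ n) h) \<le> sqrt C ^ n * gram_seminorm gram p h" for n h
  proof (induction n)
    case (Suc n)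
    have "gram_seminorm gram p ((T ^^ Suc n) h) \<le> sqrt C * gram_seminorm gram p ((T ^^ n) h)"
      using step by simp
    also have "\<dots> \<le> sqrt C * (sqrt C ^ n * gram_seminorm gram p h)"
      using Suc C(1) by (intro mult_left_mono) auto
    finally show ?case by (simp add: mult.assoc)
  qed simp
  then show "\<exists>D r. 0 \<le> D \<and> seminorm sH r \<and>
      continuous_map (VE_topology sZ star pos gram) euclideanreal r \<and>
      (\<forall>n h. gram_seminorm gram p ((T ^^ n) h) \<le> D ^ n * r h)"
    using C(1) seminorm_gram_seminorm[OF sp] continuous_gram_seminorm[OF p]
    by (intro exI[of _ "sqrt C"] exI[of _ "gram_seminorm gram p"]) auto
qed (rule lin)

end

section \<open>Off-diagonal entries of a 2-positive kernel\<close>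

theorem proposition2p19:
  fixes sZ :: "complex \<Rightarrow> 'z::{topological_ab_group_add, t2_space} \<Rightarrow> 'z"
    and star :: "'z \<Rightarrow> 'z"
    and pos :: "'z set"
    and sH :: "complex \<Rightarrow> 'h::ab_group_add \<Rightarrow> 'h"
    and gram :: "'h \<Rightarrow> 'h \<Rightarrow> 'z"
    and X :: "'x set"
    and k :: "'x \<Rightarrow> 'x \<Rightarrow> 'h \<Rightarrow> 'h"
  assumes "topological_VE_space sZ star pos sH gram"
    and "X \<noteq> {}"
    and "\<forall>x\<in>X. \<forall>y\<in>X. k x y \<in> cont_adjointable sZ star pos sH gram"
    and "two_positive star pos gram X k"
    and "\<forall>x\<in>X. m_topologisable sZ star pos sH gram (k x x)"
  shows "(\<forall>x\<in>X. \<forall>y\<in>X. \<forall>p \<in> cont_incr_seminorms sZ star pos.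
            \<exists>C\<ge>0. \<forall>h. p (gram (k y x h) (k y x h)) \<le> C * p (gram h h)) \<and>
         (\<forall>x\<in>X. \<forall>y\<in>X. m_topologisable sZ star pos sH gram (k y x))"
proof -
  interpret topological_VE_space sZ star pos sH gram by (rule assms(1))
  have lin: "Vector_Spaces.linear sH sH (k u v)" if "u \<in> X" "v \<in> X" for u v
    using assms(3) that by (auto simp: cont_adjointable_def)
  have diag: "\<exists>D\<ge>0. \<forall>h. gram_seminorm gram p (k x x h) \<le> D * gram_seminorm gram p h"
    if "x \<in> X" and p: "p \<in> cont_incr_seminorms sZ star pos" for x p
  proof -
    have sp: "seminorm sZ p" "increasing_fun star pos p"
      using p by (auto simp: cont_incr_seminorms_def)
    obtain D r where "0 \<le> D"
      "\<And>n h. gram_seminorm gram p (((k x x) ^^ n) h) \<le> D ^ n * r h"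
      using assms(5)[unfolded m_topologisable_def, rule_format, OF \<open>x \<in> X\<close>] p by metis
    then show ?thesis
      using selfadjoint_growth_imp_bounded[OF sp
          two_positive_imp_hermitian[OF assms(4) \<open>x \<in> X\<close> \<open>x \<in> X\<close> lin]] by metis
  qed
  have bounded: "\<exists>C\<ge>0. \<forall>h. p (gram (k y x h) (k y x h)) \<le> C * p (gram h h)"
    if "x \<in> X" "y \<in> X" and p: "p \<in> cont_incr_seminorms sZ star pos" for x y p
  proof -
    have sp: "seminorm sZ p" "increasing_fun star pos p"
      using p by (auto simp: cont_incr_seminorms_def)
    obtain a where a: "0 \<le> a"
      "\<And>h. gram_seminorm gram p (k x x h) \<le> a * gram_seminorm gram p h"
      using diag[OF \<open>x \<in> X\<close> p] by blast
    obtain b where b: "0 \<le> b"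
      "\<And>h. gram_seminorm gram p (k y y h) \<le> b * gram_seminorm gram p h"
      using diag[OF \<open>y \<in> X\<close> p] by blast
    \<comment> \<open>The absorption argument divides by the bound of $\mathbf{k}(y,y)$, which may be zero.\<close>
    have b': "gram_seminorm gram p (k y y h) \<le> (b + 1) * gram_seminorm gram p h" for h
      using b(2)[of h] gram_seminorm_nonneg[OF sp(1), of h] by (simp add: algebra_simps)
    have "p (gram (k y x h) (k y x h)) \<le> (b + 1) * a * p (gram h h)" for h
      using two_positive_imp_bounded[OF assms(4) that(1,2) lin sp a(2) b'] b(1) by simp
    then show ?thesis using a(1) b(1) by (intro exI[of _ "(b + 1) * a"]) auto
  qed
  have "m_topologisable sZ star pos sH gram (k y x)" if "x \<in> X" "y \<in> X" for x y
    using lin that bounded by (intro bounded_imp_m_topologisable) auto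
  then show ?thesis using bounded by blast
qed

end
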